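(* Let $h\in(0,1)$ and $\omega_0,\omega_1\in\mathbb{R}$ with $\omega_0-\omega_1=1$. Let $(U^*,0,0)$ be the shear solution given by $U^*(Y)=\omega_0(Y-h)+h(1-h)$ for $0\le Y\le h$ and $U^*(Y)=\omega_1(Y-h)+h(1-h)$ for $h\le Y\le1$. There exists a sufficiently small $\delta>0$, depending only on $\omega_0$ and $h$, such that the following holds for every solution $(U,V,\eta)$ of the two-layer problem (P), with stream function $\Psi$, satisfying $$\|U-U^*\|_{L^\infty}<\delta,\qquad (1+\|U^*\|_{L^\infty})\|\eta\|_{L^\infty}<\delta .$$ If $\omega_0<1-2h$ or $\omega_0>2-2h$, then there does not exist a single-valued function $\gamma$ such that $\omega=\gamma(\Psi)$ on $\Omega_0\cup\Omega_1$. If $1-2h<\omega_0<2-2h$, then there does exist such a function.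
   Context: Problem (P): given $h\in(0,1)$ and real $\omega_0,\omega_1$ with $\omega_0-\omega_1=1$, a solution $(U,V,\eta)$ consists of $\eta\in C^2(\mathbb{R})$ with $0<h+\eta<1$, defining $\Omega_0=\{(X,Y): 0<Y<h+\eta(X)\}$ and $\Omega_1=\{(X,Y): h+\eta(X)<Y<1\}$, and functions $U,V\in C^1(\overline{\Omega_0})\cap C^1(\overline{\Omega_1})\cap C^0(\overline{\Omega_0\cup\Omega_1})$ such that: $U_X+V_Y=0$ in $\Omega_0\cup\Omega_1$; $U_Y-V_X=\omega_i$ in $\Omega_i$ for $i=0,1$; $V=0$ on $Y=1$ and on $Y=0$; and $\eta_XU-V=0$ on $Y=h+\eta(X)$. The stream function is the function $\Psi$ with $\Psi_X=-V$, $\Psi_Y=U$ and $\Psi=0$ on $Y=h+\eta(X)$. The vorticity $\omega$ is the function equal to $\omega_0$ on $\Omega_0$ and $\omega_1$ on $\Omega_1$. *)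

theory Defs
  imports "HOL-Analysis.Analysis" "HOL-Probability.Essential_Supremum"
begin

definition lower_layer :: "real \<Rightarrow> (real \<Rightarrow> real) \<Rightarrow> (real \<times> real) set"
  where "lower_layer h \<eta> = {(X, Y). 0 < Y \<and> Y < h + \<eta> X}"

definition upper_layer :: "real \<Rightarrow> (real \<Rightarrow> real) \<Rightarrow> (real \<times> real) set"
  where "upper_layer h \<eta> = {(X, Y). h + \<eta> X < Y \<and> Y < 1}"

definition fluid_domain :: "real \<Rightarrow> (real \<Rightarrow> real) \<Rightarrow> (real \<times> real) set"
  where "fluid_domain h \<eta> = lower_layer h \<eta> \<union> upper_layer h \<eta>"

definition DX :: "(real \<times> real \<Rightarrow> real) \<Rightarrow> real \<times> real \<Rightarrow> real"
  where "DX f p = deriv (\<lambda>X. f (X, snd p)) (fst p)"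

definition DY :: "(real \<times> real \<Rightarrow> real) \<Rightarrow> real \<times> real \<Rightarrow> real"
  where "DY f p = deriv (\<lambda>Y. f (fst p, Y)) (snd p)"

text \<open>For open \<open>\<Omega>\<close>, this is \<open>f \<in> C\<^sup>1\<close> on the closure of \<open>\<Omega>\<close>: the first partial derivatives
  exist in \<open>\<Omega>\<close>, and they and \<open>f\<close> extend continuously to the closure. The extension of \<open>f\<close> is
  \<open>f\<close> itself; that of the partial derivatives is one-sided, so that they may jump across a
  boundary in the interior of the domain of \<open>f\<close>. No boundedness is required.\<close>

definition C1_closure :: "(real \<times> real) set \<Rightarrow> (real \<times> real \<Rightarrow> real) \<Rightarrow> bool"
  where "C1_closure \<Omega> f \<longleftrightarrow>
    continuous_on (closure \<Omega>) f \<and>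
    (\<forall>(X, Y)\<in>\<Omega>. (\<lambda>x. f (x, Y)) differentiable at X \<and> (\<lambda>y. f (X, y)) differentiable at Y) \<and>
    (\<exists>g. continuous_on (closure \<Omega>) g \<and> (\<forall>p\<in>\<Omega>. g p = DX f p)) \<and>
    (\<exists>g. continuous_on (closure \<Omega>) g \<and> (\<forall>p\<in>\<Omega>. g p = DY f p))"

text \<open>The values of \<open>U\<close> and \<open>V\<close> outside the closed strip \<open>0 \<le> Y \<le> 1\<close> are irrelevant.\<close>

definition two_layer_solution ::
  "real \<Rightarrow> real \<Rightarrow> real \<Rightarrow> (real \<times> real \<Rightarrow> real) \<Rightarrow> (real \<times> real \<Rightarrow> real) \<Rightarrow> (real \<Rightarrow> real) \<Rightarrow> bool"
  where "two_layer_solution h \<omega>0 \<omega>1 U V \<eta> \<longleftrightarrow>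
    \<eta> C1_differentiable_on UNIV \<and> deriv \<eta> C1_differentiable_on UNIV \<and>
    (\<forall>X. 0 < h + \<eta> X \<and> h + \<eta> X < 1) \<and>
    (\<forall>f\<in>{U, V}. C1_closure (lower_layer h \<eta>) f \<and> C1_closure (upper_layer h \<eta>) f \<and>
       continuous_on (closure (fluid_domain h \<eta>)) f) \<and>
    (\<forall>p\<in>fluid_domain h \<eta>. DX U p + DY V p = 0) \<and>
    (\<forall>p\<in>lower_layer h \<eta>. DY U p - DX V p = \<omega>0) \<and>
    (\<forall>p\<in>upper_layer h \<eta>. DY U p - DX V p = \<omega>1) \<and>
    (\<forall>X. V (X, 1) = 0) \<and>
    (\<forall>X. V (X, 0) = 0) \<and>
    (\<forall>X. deriv \<eta> X * U (X, h + \<eta> X) - V (X, h + \<eta> X) = 0)"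

text \<open>These conditions determine \<open>\<Psi>\<close> uniquely on the closed strip. For a solution, the formulas
  for the partial derivatives then hold across the interface too, since \<open>U\<close> and \<open>V\<close> are
  continuous there.\<close>

definition stream_function ::
  "real \<Rightarrow> (real \<times> real \<Rightarrow> real) \<Rightarrow> (real \<times> real \<Rightarrow> real) \<Rightarrow> (real \<Rightarrow> real) \<Rightarrow> (real \<times> real \<Rightarrow> real) \<Rightarrow> bool"
  where "stream_function h U V \<eta> \<Psi> \<longleftrightarrow>
    continuous_on (closure (fluid_domain h \<eta>)) \<Psi> \<and>
    (\<forall>(X, Y)\<in>fluid_domain h \<eta>.
       ((\<lambda>x. \<Psi> (x, Y)) has_real_derivative - V (X, Y)) (at X) \<and>
       ((\<lambda>y. \<Psi> (X, y)) has_real_derivative U (X, Y)) (at Y)) \<and>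
    (\<forall>X. \<Psi> (X, h + \<eta> X) = 0)"

text \<open>Only the values on \<open>fluid_domain h \<eta>\<close> are meaningful.\<close>

definition vorticity :: "real \<Rightarrow> real \<Rightarrow> real \<Rightarrow> (real \<Rightarrow> real) \<Rightarrow> real \<times> real \<Rightarrow> real"
  where "vorticity h \<omega>0 \<omega>1 \<eta> p = (if p \<in> lower_layer h \<eta> then \<omega>0 else \<omega>1)"

definition U_shear :: "real \<Rightarrow> real \<Rightarrow> real \<Rightarrow> real \<Rightarrow> real"
  where "U_shear h \<omega>0 \<omega>1 Y =
    (if Y \<le> h then \<omega>0 * (Y - h) + h * (1 - h) else \<omega>1 * (Y - h) + h * (1 - h))"

definition Linf_norm :: "'a::euclidean_space set \<Rightarrow> ('a \<Rightarrow> real) \<Rightarrow> ereal"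
  where "Linf_norm S f = esssup (lebesgue_on S) (\<lambda>x. ereal \<bar>f x\<bar>)"

end

theory Submission
  imports Defs
begin

text \<open>
  Fix \<open>X\<close> and measure height from the interface by \<open>t = Y - (h + \<eta> X)\<close>. There \<open>\<Psi>\<close> vanishes, and
  \<open>\<Psi>\<^sub>Y = U\<close> differs by a small multiple of \<open>\<delta>\<close> from the linear shear \<open>m + \<omega>\<^sub>i * t\<close>, where
  \<open>m = h * (1 - h) > 0\<close> is the velocity of the shear solution at its interface. Integrating,
  \<open>\<Psi> = t * (m + \<omega>\<^sub>i * t / 2 + e)\<close> with an error \<open>e\<close> of order \<open>\<delta>\<close>. The bracket without \<open>e\<close>, the mean
  velocity between the interface and the height \<open>t\<close>, is affine in \<open>t\<close>. It is therefore controlled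
  by its value \<open>m > 0\<close> at the interface and its value at the wall, which for the shear solution is
  \<open>h / 2 * (2 - 2 * h - \<omega>0)\<close> in the lower layer and \<open>(1 - h) / 2 * (\<omega>0 - (1 - 2 * h))\<close> in the upper one.

  If both wall values are positive, then \<open>\<Psi>\<close> has the sign of \<open>t\<close>, so that its sign tells the
  layers apart, and \<open>\<gamma>\<close> can be a step function
  (\<open>layer_profile_pos\<close>, \<open>vorticity_eq_function_of_stream_if_signs\<close>). If one of them is negative, then \<open>\<Psi>\<close> changes sign
  between the interface and that wall, and so takes in that layer also all small values of the sign
  that it has just beyond the interface. Some value is then common to the two layers, which excludes any \<open>\<gamma>\<close>
  because \<open>\<omega>0 \<noteq> \<omega>1\<close> (\<open>layer_profiles_take_opposite_values\<close>,
  \<open>vorticity_neq_function_of_stream_if_common_value\<close>).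

  Integration is replaced by the mean value theorem, and the \<open>L\<^sup>\<infinity>\<close> bounds hold pointwise since
  the functions concerned are continuous on open sets (\<open>abs_le_of_Linf_norm_less\<close>).
\<close>

section \<open>Essential suprema of continuous functions\<close>

text \<open>The set where \<open>\<bar>f\<bar> > c\<close> is open and of measure zero, hence empty.\<close>

lemma abs_le_of_Linf_norm_less:
  fixes f :: "'a::euclidean_space \<Rightarrow> real"
  assumes "open S" and "continuous_on S f" and "Linf_norm S f < ereal c" and "x \<in> S"
  shows "\<bar>f x\<bar> \<le> c"
proof -
  let ?B = "{x \<in> S. \<bar>f x\<bar> > c}"
  have "AE x in lebesgue_on S. ereal \<bar>f x\<bar> \<le> Linf_norm S f"
    unfolding Linf_norm_def by (rule esssup_AE)
  then have "AE x in lebesgue_on S. \<bar>f x\<bar> \<le> c"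
  proof (rule eventually_mono)
    fix x assume "ereal \<bar>f x\<bar> \<le> Linf_norm S f"
    also note assms(3)
    finally show "\<bar>f x\<bar> \<le> c" by simp
  qed
  then have "AE x in lebesgue. x \<in> S \<longrightarrow> \<bar>f x\<bar> \<le> c"
    using assms(1) by (subst (asm) AE_restrict_space_iff) (auto intro: lborelD)
  then have AE: "AE x in lebesgue. x \<notin> ?B"
    by (auto elim!: eventually_mono)
  have opB: "open ?B"
  proof -
    have "continuous_on S (\<lambda>x. \<bar>f x\<bar>)"
      by (intro continuous_intros assms)
    then have "open (S \<inter> (\<lambda>x. \<bar>f x\<bar>) -` {c<..})"
      using assms(1) by (intro continuous_open_preimage) auto
    then show ?thesis
      by (auto simp: vimage_def Int_def)
  qed
  then have "?B \<in> null_sets lebesgue"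
    using AE by (subst AE_iff_null_sets) (auto intro: lborelD)
  then have "?B = {}"
    using open_not_negligible[OF opB] by (auto simp: negligible_iff_null_sets)
  then show ?thesis
    using assms(4) by force
qed

text \<open>On a null set the essential supremum of any measurable function is \<open>- \<infinity>\<close>, whence the
  assumption.\<close>

lemma Linf_norm_nonneg:
  assumes "emeasure (lebesgue_on S) S \<noteq> 0"
  shows "0 \<le> Linf_norm S f"
proof (rule ccontr)
  assume neg: "\<not> 0 \<le> Linf_norm S f"
  have "AE x in lebesgue_on S. ereal \<bar>f x\<bar> \<le> Linf_norm S f"
    unfolding Linf_norm_def by (rule esssup_AE)
  then have "AE x in lebesgue_on S. False"
  proof (rule eventually_mono)
    fix x assume "ereal \<bar>f x\<bar> \<le> Linf_norm S f"
    moreover have "0 \<le> ereal \<bar>f x\<bar>" by simp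
    ultimately show False using neg by (meson order_trans)
  qed
  then have "emeasure (lebesgue_on S) (space (lebesgue_on S)) = 0"
    using AE_iff_measurable[of "space (lebesgue_on S)" "lebesgue_on S" "\<lambda>_. False"] by simp
  then show False
    using assms by simp
qed

section \<open>Nearly linear velocity profiles on an interval\<close>

text \<open>A profile is the stream function in one layer, as a function of the distance \<open>s\<close> from the
  interface into a layer of thickness \<open>T\<close>. Both layers are treated alike when the sign is chosen
  so that \<open>F\<close> increases away from the interface; this is why the lower layer will appear with \<open>- \<Psi>\<close>
  and the slope \<open>- \<omega>0\<close>.\<close>

definition layer_profile :: "real \<Rightarrow> real \<Rightarrow> real \<Rightarrow> real \<Rightarrow> (real \<Rightarrow> real) \<Rightarrow> bool"
  where "layer_profile m a \<epsilon> T F \<longleftrightarrow> continuous_on {0..T} F \<and> F 0 = 0 \<and>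
    (\<forall>s\<in>{0<..<T}. \<exists>D. (F has_real_derivative D) (at s) \<and> \<bar>D - (m + a * s)\<bar> \<le> \<epsilon>)"

text \<open>The mean value theorem for the difference of \<open>F\<close> and the parabola, a primitive of the linear
  profile. The error vanishes linearly at the interface, so that it can be absorbed in the factor
  \<open>m + a * s / 2\<close>, and the sign of \<open>F\<close> is known right up to the interface.\<close>

lemma layer_profile_close_to_parabola:
  assumes "layer_profile m a \<epsilon> T F" and "0 < s" and "s \<le> T"
  shows "\<bar>F s - s * (m + a * s / 2)\<bar> \<le> s * \<epsilon>"
proof -
  define G where "G = (\<lambda>r. F r - r * (m + a * r / 2))"
  have der: "\<exists>D. (G has_real_derivative D) (at r) \<and> \<bar>D\<bar> \<le> \<epsilon>" if "0 < r" "r < s" for r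
  proof -
    obtain D where D: "(F has_real_derivative D) (at r)" "\<bar>D - (m + a * r)\<bar> \<le> \<epsilon>"
      using assms \<open>0 < r\<close> \<open>r < s\<close> unfolding layer_profile_def by force
    have "(G has_real_derivative D - (m + a * r)) (at r)"
      unfolding G_def by (rule derivative_eq_intros D(1) refl | simp add: field_simps)+
    with D(2) show ?thesis by blast
  qed
  have "continuous_on {0..s} F"
    using assms unfolding layer_profile_def by (auto intro: continuous_on_subset)
  then have "continuous_on {0..s} G"
    unfolding G_def by (intro continuous_intros) auto
  moreover have "G differentiable at r" if "0 < r" "r < s" for r
    using der[OF that] by (auto simp: real_differentiable_def)
  ultimately obtain l z where z: "0 < z" "z < s" "(G has_real_derivative l) (at z)"
      "G s - G 0 = (s - 0) * l"
    using MVT[OF \<open>0 < s\<close>] by blast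
  have "\<bar>l\<bar> \<le> \<epsilon>"
    using der[OF z(1,2)] DERIV_unique[OF z(3)] by blast
  moreover have "G s = s * l"
    using z(4) assms(1) by (simp add: G_def layer_profile_def)
  ultimately have "\<bar>G s\<bar> \<le> s * \<epsilon>"
    using assms(2) by (simp add: abs_mult)
  then show ?thesis
    by (simp add: G_def)
qed

text \<open>The mean velocity \<open>m + a * s / 2\<close> is affine in \<open>s\<close>, hence at least the smaller of its values
  at the two ends of the layer.\<close>

lemma layer_profile_pos:
  assumes "layer_profile m a \<epsilon> T F" and "0 < s" and "s \<le> T"
    and "\<epsilon> < m" and "\<epsilon> < m + a * T / 2"
  shows "0 < F s"
proof -
  have "\<epsilon> < m + a * s / 2"
  proof (cases "0 \<le> a")
    case True
    then have "0 \<le> a * s / 2" using assms(2) by simp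
    then show ?thesis using assms(4) by linarith
  next
    case False
    then have "a * T \<le> a * s" using assms(3) by (simp add: mult_left_mono_neg)
    then show ?thesis using assms(5) by linarith
  qed
  then have "s * \<epsilon> < s * (m + a * s / 2)"
    using assms(2) by simp
  then show ?thesis
    using layer_profile_close_to_parabola[OF assms(1-3)] by linarith
qed

lemma layer_profile_pos_near_0:
  assumes "layer_profile m a \<epsilon> T F" and "0 < T" and "\<epsilon> < m"
  obtains s where "0 < s" "s \<le> T" "0 < F s"
proof -
  \<comment> \<open>For such \<open>s\<close> the term \<open>a * s / 2\<close> uses up at most half of the margin \<open>m - \<epsilon>\<close>.\<close>
  define s where "s = min T ((m - \<epsilon>) / (\<bar>a\<bar> + 1))"
  have s: "0 < s" "s \<le> T"
    using assms by (auto simp: s_def)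
  have "s \<le> (m - \<epsilon>) / (\<bar>a\<bar> + 1)"
    by (simp add: s_def)
  then have "s * (\<bar>a\<bar> + 1) \<le> m - \<epsilon>"
    by (simp add: pos_le_divide_eq)
  moreover have "\<bar>a * s\<bar> = \<bar>a\<bar> * s"
    using s by (simp add: abs_mult)
  ultimately have "\<epsilon> < m + a * s / 2"
    using s assms(3) by (simp add: algebra_simps)
  then have "s * \<epsilon> < s * (m + a * s / 2)"
    using s by simp
  then have "0 < F s"
    using layer_profile_close_to_parabola[OF assms(1) s] by linarith
  with s that show ?thesis by blast
qed

lemma layer_profile_end_neg:
  assumes "layer_profile m a \<epsilon> T F" and "0 < T" and "m + a * T / 2 < - \<epsilon>"
  shows "F T < 0"
proof -
  have "T * (m + a * T / 2) < T * (- \<epsilon>)"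
    using assms(2,3) by (intro mult_strict_left_mono)
  then show ?thesis
    using layer_profile_close_to_parabola[OF assms(1,2)] by force
qed

text \<open>\<open>G\<close> takes all small positive values by the intermediate value theorem. \<open>F\<close> falls from \<open>0\<close> at
  the interface to a negative value at the wall, hence takes all small negative ones.\<close>

lemma layer_profiles_take_opposite_values:
  assumes F: "layer_profile m a \<epsilon> T F" "0 < T" and G: "layer_profile m b \<epsilon> S G" "0 < S"
    and "\<epsilon> < m" and "m + a * T / 2 < - \<epsilon>"
  obtains t s where "0 < t" "t < T" "0 < s" "s < S" "F t = - G s"
proof -
  have FT: "F T < 0"
    by (rule layer_profile_end_neg) (use assms in auto)
  obtain r where r: "0 < r" "r \<le> S" "0 < G r"
    using layer_profile_pos_near_0[OF G \<open>\<epsilon> < m\<close>] .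
  define c where "c = min (- F T) (G r) / 2"
  have c: "0 < c" "c < - F T" "c < G r"
    using FT r(3) by (auto simp: c_def min_def)
  have "continuous_on {0..T} F" "F 0 = 0"
    using F(1) by (auto simp: layer_profile_def)
  then obtain t where t: "0 \<le> t" "t \<le> T" "F t = - c"
    using IVT2'[of F T "- c" 0] c \<open>0 < T\<close> by auto
  have "continuous_on {0..r} G" "G 0 = 0"
    using G(1) r(2) by (auto simp: layer_profile_def intro: continuous_on_subset)
  then obtain s where s: "0 \<le> s" "s \<le> r" "G s = c"
    using IVT'[of G 0 c r] c r by auto
  show ?thesis
  proof (rule that)
    show "0 < t" "t < T" using t c \<open>F 0 = 0\<close> by (auto simp: less_le)
    show "0 < s" "s < S" using s r c \<open>G 0 = 0\<close> by (auto simp: less_le)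
    show "F t = - G s" using t s by simp
  qed
qed

section \<open>The stream function along a vertical line\<close>

lemma open_fluid_domain:
  assumes "continuous_on UNIV \<eta>"
  shows "open (fluid_domain h \<eta>)"
proof -
  have *: "continuous_on UNIV (\<lambda>p::real \<times> real. h + \<eta> (fst p))"
    by (intro continuous_intros continuous_on_compose2[OF assms]) auto
  have "fluid_domain h \<eta> =
    {p. 0 < snd p} \<inter> {p. snd p < h + \<eta> (fst p)} \<union> {p. h + \<eta> (fst p) < snd p} \<inter> {p. snd p < 1}"
    by (auto simp: fluid_domain_def lower_layer_def upper_layer_def)
  also have "open \<dots>"
    by (intro open_Un open_Int open_Collect_less * continuous_intros)
  finally show ?thesis .
qed

text \<open>This makes \<open>\<Psi>\<close>, which is continuous on the closure of the fluid domain only, continuous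
  along the whole vertical segment, up to the interface and the walls.\<close>

lemma vertical_segment_subset_closure:
  assumes "0 < h + \<eta> X" and "h + \<eta> X < 1" and "0 \<le> Y" and "Y \<le> 1"
  shows "(X, Y) \<in> closure (fluid_domain h \<eta>)"
proof -
  have "Pair X ` closure ({0<..<h + \<eta> X} \<union> {h + \<eta> X<..<1}) \<subseteq> closure (fluid_domain h \<eta>)"
  proof (rule image_closure_subset)
    show "Pair X ` ({0<..<h + \<eta> X} \<union> {h + \<eta> X<..<1}) \<subseteq> closure (fluid_domain h \<eta>)"
      by (rule order_trans[OF _ closure_subset])
        (auto simp: fluid_domain_def lower_layer_def upper_layer_def)
  qed (auto intro!: continuous_intros)
  moreover have "Y \<in> closure ({0<..<h + \<eta> X} \<union> {h + \<eta> X<..<1})"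
    using assms by (auto simp: closure_Un)
  ultimately show ?thesis by blast
qed

lemma continuous_U_shear: "continuous_on UNIV (U_shear h \<omega>0 \<omega>1)"
proof -
  have "continuous_on ({..h} \<union> {h..}) (\<lambda>Y. if Y \<le> h then \<omega>0 * (Y - h) + h * (1 - h)
      else \<omega>1 * (Y - h) + h * (1 - h))"
    by (rule continuous_on_If) (auto intro!: continuous_intros)
  moreover have "{..h} \<union> {h..} = UNIV" by auto
  ultimately show ?thesis by (simp add: U_shear_def[abs_def])
qed

text \<open>Moving the interface of the shear solution by \<open>e\<close> costs a multiple of \<open>\<bar>e\<bar>\<close>, also in the strip
  between the old and the new interface, where the two flows have different vorticities.\<close>

lemma U_shear_shift_lower:
  assumes "t \<le> 0"
  shows "\<bar>U_shear h \<omega>0 \<omega>1 (h + e + t) - (h * (1 - h) + \<omega>0 * t)\<bar> \<le> (\<bar>\<omega>0\<bar> + \<bar>\<omega>1\<bar>) * \<bar>e\<bar>"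
proof (cases "e + t \<le> 0")
  case True
  then show ?thesis
    by (simp add: U_shear_def algebra_simps abs_mult flip: abs_mult)
next
  case False
  have "\<bar>\<omega>1 * (e + t) - \<omega>0 * t\<bar> \<le> \<bar>\<omega>1\<bar> * \<bar>e + t\<bar> + \<bar>\<omega>0\<bar> * \<bar>t\<bar>"
    by (metis abs_mult abs_triangle_ineq4)
  also have "\<dots> \<le> \<bar>\<omega>1\<bar> * \<bar>e\<bar> + \<bar>\<omega>0\<bar> * \<bar>e\<bar>"
    using False assms by (intro add_mono mult_left_mono) auto
  finally show ?thesis
    using False by (simp add: U_shear_def algebra_simps)
qed

lemma U_shear_shift_upper:
  assumes "0 \<le> t"
  shows "\<bar>U_shear h \<omega>0 \<omega>1 (h + e + t) - (h * (1 - h) + \<omega>1 * t)\<bar> \<le> (\<bar>\<omega>0\<bar> + \<bar>\<omega>1\<bar>) * \<bar>e\<bar>"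
proof (cases "e + t > 0")
  case True
  then show ?thesis
    by (simp add: U_shear_def algebra_simps abs_mult flip: abs_mult)
next
  case False
  have "\<bar>\<omega>0 * (e + t) - \<omega>1 * t\<bar> \<le> \<bar>\<omega>0\<bar> * \<bar>e + t\<bar> + \<bar>\<omega>1\<bar> * \<bar>t\<bar>"
    by (metis abs_mult abs_triangle_ineq4)
  also have "\<dots> \<le> \<bar>\<omega>0\<bar> * \<bar>e\<bar> + \<bar>\<omega>1\<bar> * \<bar>e\<bar>"
    using False assms by (intro add_mono mult_left_mono) auto
  finally show ?thesis
    using False by (simp add: U_shear_def algebra_simps)
qed

text \<open>Of the error \<open>\<epsilon>\<close>, one \<open>\<delta>\<close> comes from the distance of \<open>U\<close> to the shear solution and the
  rest from the displacement \<open>\<eta> X\<close> of the interface.\<close>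

lemma stream_function_layer_profiles:
  assumes \<Psi>: "stream_function h U V \<eta> \<Psi>"
    and b: "0 < h + \<eta> X" "h + \<eta> X < 1"
    and U: "\<And>Y. (X, Y) \<in> fluid_domain h \<eta> \<Longrightarrow> \<bar>U (X, Y) - U_shear h \<omega>0 \<omega>1 Y\<bar> \<le> \<delta>"
    and \<eta>: "\<bar>\<eta> X\<bar> \<le> \<delta>"
  defines "\<epsilon> \<equiv> (1 + \<bar>\<omega>0\<bar> + \<bar>\<omega>1\<bar>) * \<delta>"
  shows "layer_profile (h * (1 - h)) (- \<omega>0) \<epsilon> (h + \<eta> X) (\<lambda>s. - \<Psi> (X, h + \<eta> X - s))"
    and "layer_profile (h * (1 - h)) \<omega>1 \<epsilon> (1 - (h + \<eta> X)) (\<lambda>s. \<Psi> (X, h + \<eta> X + s))"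
proof -
  let ?b = "h + \<eta> X"
  have "continuous_on (Pair X ` {0..1}) \<Psi>"
    by (rule continuous_on_subset[of "closure (fluid_domain h \<eta>)"])
      (use \<Psi> vertical_segment_subset_closure[of h \<eta> X] b in \<open>auto simp: stream_function_def\<close>)
  then have cont: "continuous_on {0..1} (\<lambda>Y. \<Psi> (X, Y))"
    by (intro continuous_on_compose2[of "Pair X ` {0..1}" \<Psi> "{0..1}" "Pair X"] continuous_intros)
      auto
  have zero: "\<Psi> (X, ?b) = 0"
    using \<Psi> by (simp add: stream_function_def)
  have der: "((\<lambda>y. \<Psi> (X, y)) has_real_derivative U (X, Y)) (at Y)"
    if "(X, Y) \<in> fluid_domain h \<eta>" for Y
    using \<Psi> that by (auto simp: stream_function_def)
  have shift: "(\<bar>\<omega>0\<bar> + \<bar>\<omega>1\<bar>) * \<bar>\<eta> X\<bar> \<le> (\<bar>\<omega>0\<bar> + \<bar>\<omega>1\<bar>) * \<delta>"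
    using \<eta> by (intro mult_left_mono) auto
  have eps: "\<epsilon> = \<delta> + (\<bar>\<omega>0\<bar> + \<bar>\<omega>1\<bar>) * \<delta>"
    by (simp add: \<epsilon>_def algebra_simps)
  show "layer_profile (h * (1 - h)) (- \<omega>0) \<epsilon> ?b (\<lambda>s. - \<Psi> (X, ?b - s))"
    unfolding layer_profile_def
  proof (intro conjI ballI)
    show "continuous_on {0..?b} (\<lambda>s. - \<Psi> (X, ?b - s))"
      using b by (intro continuous_intros continuous_on_compose2[OF cont]) auto
    fix s assume s: "s \<in> {0<..<?b}"
    then have mem: "(X, ?b - s) \<in> fluid_domain h \<eta>"
      by (auto simp: fluid_domain_def lower_layer_def)
    have "((\<lambda>s. - \<Psi> (X, ?b - s)) has_real_derivative U (X, ?b - s)) (at s)"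
      by (auto intro!: derivative_eq_intros
          DERIV_chain2[where f = "\<lambda>y. \<Psi> (X, y)" and g = "\<lambda>s. ?b - s"] der[OF mem])
    moreover have "\<bar>U_shear h \<omega>0 \<omega>1 (?b - s) - (h * (1 - h) + - \<omega>0 * s)\<bar> \<le> \<epsilon> - \<delta>"
      using order_trans[OF U_shear_shift_lower[of "- s" h \<omega>0 \<omega>1 "\<eta> X"] shift] s
      by (simp add: eps)
    then have "\<bar>U (X, ?b - s) - (h * (1 - h) + - \<omega>0 * s)\<bar> \<le> \<epsilon>"
      using U[OF mem] by linarith
    ultimately show "\<exists>D. ((\<lambda>s. - \<Psi> (X, ?b - s)) has_real_derivative D) (at s) \<and>
        \<bar>D - (h * (1 - h) + - \<omega>0 * s)\<bar> \<le> \<epsilon>" by blast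
  qed (simp add: zero)
  show "layer_profile (h * (1 - h)) \<omega>1 \<epsilon> (1 - ?b) (\<lambda>s. \<Psi> (X, ?b + s))"
    unfolding layer_profile_def
  proof (intro conjI ballI)
    show "continuous_on {0..1 - ?b} (\<lambda>s. \<Psi> (X, ?b + s))"
      using b by (intro continuous_intros continuous_on_compose2[OF cont]) auto
    fix s assume s: "s \<in> {0<..<1 - ?b}"
    then have mem: "(X, ?b + s) \<in> fluid_domain h \<eta>"
      by (auto simp: fluid_domain_def upper_layer_def)
    have "((\<lambda>s. \<Psi> (X, ?b + s)) has_real_derivative U (X, ?b + s)) (at s)"
      using DERIV_at_within_shift[of "\<lambda>y. \<Psi> (X, y)" "U (X, ?b + s)" ?b s UNIV] der[OF mem]
      by (simp only: surj_plus)
    moreover have "\<bar>U_shear h \<omega>0 \<omega>1 (?b + s) - (h * (1 - h) + \<omega>1 * s)\<bar> \<le> \<epsilon> - \<delta>"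
      using order_trans[OF U_shear_shift_upper[of s h \<omega>0 \<omega>1 "\<eta> X"] shift] s
      by (simp add: eps)
    then have "\<bar>U (X, ?b + s) - (h * (1 - h) + \<omega>1 * s)\<bar> \<le> \<epsilon>"
      using U[OF mem] by linarith
    ultimately show "\<exists>D. ((\<lambda>s. \<Psi> (X, ?b + s)) has_real_derivative D) (at s) \<and>
        \<bar>D - (h * (1 - h) + \<omega>1 * s)\<bar> \<le> \<epsilon>" by blast
  qed (simp add: zero)
qed

section \<open>Vorticity as a function of the stream function\<close>

lemma vorticity_eq_function_of_stream_if_signs:
  assumes "\<And>p. p \<in> lower_layer h \<eta> \<Longrightarrow> \<Psi> p < 0" and "\<And>p. p \<in> upper_layer h \<eta> \<Longrightarrow> 0 < \<Psi> p"
  shows "\<exists>\<gamma> :: real \<Rightarrow> real. \<forall>p\<in>fluid_domain h \<eta>. vorticity h \<omega>0 \<omega>1 \<eta> p = \<gamma> (\<Psi> p)"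
proof (intro exI ballI)
  fix p assume "p \<in> fluid_domain h \<eta>"
  then show "vorticity h \<omega>0 \<omega>1 \<eta> p = (\<lambda>s. if s < 0 then \<omega>0 else \<omega>1) (\<Psi> p)"
    using assms[of p] by (auto simp: fluid_domain_def vorticity_def)
qed

lemma vorticity_neq_function_of_stream_if_common_value:
  assumes "p \<in> lower_layer h \<eta>" and "q \<in> upper_layer h \<eta>" and "\<Psi> p = \<Psi> q" and "\<omega>0 \<noteq> \<omega>1"
  shows "\<not> (\<exists>\<gamma> :: real \<Rightarrow> real. \<forall>p\<in>fluid_domain h \<eta>. vorticity h \<omega>0 \<omega>1 \<eta> p = \<gamma> (\<Psi> p))"
proof
  assume "\<exists>\<gamma> :: real \<Rightarrow> real. \<forall>p\<in>fluid_domain h \<eta>. vorticity h \<omega>0 \<omega>1 \<eta> p = \<gamma> (\<Psi> p)"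
  then have "vorticity h \<omega>0 \<omega>1 \<eta> p = vorticity h \<omega>0 \<omega>1 \<eta> q"
    using assms(1-3) by (auto simp: fluid_domain_def)
  moreover have "q \<notin> lower_layer h \<eta>"
    using assms(2) by (auto simp: lower_layer_def upper_layer_def)
  ultimately show False
    using assms(1,4) by (simp add: vorticity_def)
qed

theorem proposition2p4:
  fixes h \<omega>0 \<omega>1 :: real
  assumes "0 < h" and "h < 1" and "\<omega>0 - \<omega>1 = 1"
  shows "\<exists>\<delta>>0. \<forall>U V \<eta> \<Psi>.
    two_layer_solution h \<omega>0 \<omega>1 U V \<eta> \<longrightarrow>
    stream_function h U V \<eta> \<Psi> \<longrightarrow>
    Linf_norm (fluid_domain h \<eta>) (\<lambda>(X, Y). U (X, Y) - U_shear h \<omega>0 \<omega>1 Y) < ereal \<delta> \<longrightarrow>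
    (1 + Linf_norm {0..1} (U_shear h \<omega>0 \<omega>1)) * Linf_norm UNIV \<eta> < ereal \<delta> \<longrightarrow>
    (\<omega>0 < 1 - 2 * h \<or> \<omega>0 > 2 - 2 * h \<longrightarrow>
      \<not> (\<exists>\<gamma> :: real \<Rightarrow> real. \<forall>p\<in>fluid_domain h \<eta>. vorticity h \<omega>0 \<omega>1 \<eta> p = \<gamma> (\<Psi> p))) \<and>
    (1 - 2 * h < \<omega>0 \<and> \<omega>0 < 2 - 2 * h \<longrightarrow>
      (\<exists>\<gamma> :: real \<Rightarrow> real. \<forall>p\<in>fluid_domain h \<eta>. vorticity h \<omega>0 \<omega>1 \<eta> p = \<gamma> (\<Psi> p)))"
proof -
  define m where "m = h * (1 - h)"
  define K where "K = 1 + \<bar>\<omega>0\<bar> + \<bar>\<omega>1\<bar>"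
  \<comment> \<open>mean velocities of the lower and the upper layer of the shear solution\<close>
  define v0 where "v0 = m + - \<omega>0 * h / 2"
  define v1 where "v1 = m + \<omega>1 * (1 - h) / 2"
  \<comment> \<open>If \<open>v0\<close> or \<open>v1\<close> vanishes, then \<open>\<omega>0\<close> is \<open>2 - 2 * h\<close> or \<open>1 - 2 * h\<close>, where nothing is asserted; the
    value \<open>1\<close> only keeps \<open>\<delta>\<close> positive.\<close>
  define gap where "gap = (\<lambda>v::real. if v = 0 then 1 else \<bar>v\<bar>)"
  define \<delta> where "\<delta> = min m (min (gap v0) (gap v1)) / (4 * K)"
  have m: "0 < m" using assms by (simp add: m_def)
  have K: "0 < K" by (simp add: K_def)
  have gap: "0 < gap v" for v by (simp add: gap_def)
  have \<delta>: "0 < \<delta>" using m K gap by (simp add: \<delta>_def)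
  have "4 * K * \<delta> = min m (min (gap v0) (gap v1))"
    using K by (simp add: \<delta>_def)
  then have small: "2 * K * \<delta> < m" "2 * K * \<delta> < gap v0" "2 * K * \<delta> < gap v1"
    using m gap[of v0] gap[of v1] by (simp_all add: min_def split: if_splits)
  have v0_eq: "v0 = h / 2 * (2 - 2 * h - \<omega>0)"
    by (simp add: v0_def m_def field_simps)
  have v1_eq: "v1 = (1 - h) / 2 * (\<omega>0 - (1 - 2 * h))"
    using assms(3) by (simp add: v1_def m_def field_simps)
  show ?thesis
  proof (intro exI[of _ \<delta>] conjI allI impI)
    show "0 < \<delta>" by (rule \<delta>)
  next
    fix U V :: "real \<times> real \<Rightarrow> real" and \<eta> \<Psi>
    assume sol: "two_layer_solution h \<omega>0 \<omega>1 U V \<eta>" and \<Psi>: "stream_function h U V \<eta> \<Psi>"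
      and U_Linf: "Linf_norm (fluid_domain h \<eta>) (\<lambda>(X, Y). U (X, Y) - U_shear h \<omega>0 \<omega>1 Y) < ereal \<delta>"
      and \<eta>_Linf: "(1 + Linf_norm {0..1} (U_shear h \<omega>0 \<omega>1)) * Linf_norm UNIV \<eta> < ereal \<delta>"
    have cont\<eta>: "continuous_on UNIV \<eta>"
      using sol by (auto simp: two_layer_solution_def intro: C1_differentiable_imp_continuous_on)
    have b: "0 < h + \<eta> X" "h + \<eta> X < 1" for X
      using sol by (auto simp: two_layer_solution_def)
    have "continuous_on (closure (fluid_domain h \<eta>)) U"
      using sol by (auto simp: two_layer_solution_def)
    then have "continuous_on (fluid_domain h \<eta>) U"
      by (rule continuous_on_subset[OF _ closure_subset])
    then have "continuous_on (fluid_domain h \<eta>) (\<lambda>(X, Y). U (X, Y) - U_shear h \<omega>0 \<omega>1 Y)"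
      unfolding case_prod_unfold
      by (auto intro!: continuous_intros continuous_on_compose2[OF continuous_U_shear])
    from abs_le_of_Linf_norm_less[OF open_fluid_domain[OF cont\<eta>] this U_Linf]
    have U_close: "\<bar>U (X, Y) - U_shear h \<omega>0 \<omega>1 Y\<bar> \<le> \<delta>" if "(X, Y) \<in> fluid_domain h \<eta>" for X Y
      using that by fastforce
    have "0 \<le> Linf_norm {0..1} (U_shear h \<omega>0 \<omega>1)" "0 \<le> Linf_norm UNIV \<eta>"
      by (auto intro!: Linf_norm_nonneg simp: emeasure_restrict_space)
    then have "1 * Linf_norm UNIV \<eta> \<le> (1 + Linf_norm {0..1} (U_shear h \<omega>0 \<omega>1)) * Linf_norm UNIV \<eta>"
      by (intro ereal_mult_right_mono) (auto simp: add_increasing2)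
    with \<eta>_Linf have "Linf_norm UNIV \<eta> < ereal \<delta>"
      by simp
    then have \<eta>_close: "\<bar>\<eta> X\<bar> \<le> \<delta>" for X
      using abs_le_of_Linf_norm_less[OF open_UNIV cont\<eta>] by blast
    \<comment> \<open>Two errors of size at most \<open>K * \<delta>\<close> enter: the \<open>\<epsilon>\<close> of the profiles, and the change of the mean
      velocities because the layers are thicker or thinner by \<open>\<eta> X\<close>. Hence the factor 2 in \<open>small\<close>.\<close>
    note profiles = stream_function_layer_profiles[OF \<Psi> b U_close \<eta>_close, folded m_def K_def]
    have Kabs: "\<bar>\<omega>0\<bar> * \<delta> + \<bar>\<omega>1\<bar> * \<delta> \<le> K * \<delta>" "0 \<le> \<bar>\<omega>0\<bar> * \<delta>" "0 \<le> \<bar>\<omega>1\<bar> * \<delta>"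
      using \<delta> by (simp_all add: K_def algebra_simps)
    have end0: "\<bar>m + - \<omega>0 * (h + \<eta> X) / 2 - v0\<bar> \<le> K * \<delta>" for X
    proof -
      have "m + - \<omega>0 * (h + \<eta> X) / 2 - v0 = - (\<omega>0 * \<eta> X) / 2"
        by (simp add: v0_def field_simps)
      moreover have "\<bar>\<omega>0 * \<eta> X\<bar> \<le> \<bar>\<omega>0\<bar> * \<delta>"
        unfolding abs_mult by (intro mult_left_mono \<eta>_close) auto
      ultimately show ?thesis using Kabs by simp
    qed
    have end1: "\<bar>m + \<omega>1 * (1 - (h + \<eta> X)) / 2 - v1\<bar> \<le> K * \<delta>" for X
    proof -
      have "m + \<omega>1 * (1 - (h + \<eta> X)) / 2 - v1 = - (\<omega>1 * \<eta> X) / 2"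
        by (simp add: v1_def field_simps)
      moreover have "\<bar>\<omega>1 * \<eta> X\<bar> \<le> \<bar>\<omega>1\<bar> * \<delta>"
        unfolding abs_mult by (intro mult_left_mono \<eta>_close) auto
      ultimately show ?thesis using Kabs by simp
    qed
    have "0 < K * \<delta>" using K \<delta> by simp
    then have Km: "K * \<delta> < m" using small by linarith
    show "\<not> (\<exists>\<gamma> :: real \<Rightarrow> real. \<forall>p\<in>fluid_domain h \<eta>. vorticity h \<omega>0 \<omega>1 \<eta> p = \<gamma> (\<Psi> p))"
      if "\<omega>0 < 1 - 2 * h \<or> \<omega>0 > 2 - 2 * h"
    proof -
      have "\<exists>s t. 0 < s \<and> s < h + \<eta> 0 \<and> 0 < t \<and> t < 1 - (h + \<eta> 0) \<and>
          \<Psi> (0, h + \<eta> 0 - s) = \<Psi> (0, h + \<eta> 0 + t)"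
        using that
      proof
        assume "\<omega>0 < 1 - 2 * h"
        then have "v1 < 0" using assms(2) by (simp add: v1_eq mult_pos_neg)
        then have "m + \<omega>1 * (1 - (h + \<eta> 0)) / 2 < - (K * \<delta>)"
          using end1[of 0] small(3) by (simp add: gap_def)
        then obtain t s where "0 < t" "t < 1 - (h + \<eta> 0)" "0 < s" "s < h + \<eta> 0"
            "\<Psi> (0, h + \<eta> 0 + t) = - (- \<Psi> (0, h + \<eta> 0 - s))"
          using layer_profiles_take_opposite_values[OF profiles(2)[of 0] _ profiles(1)[of 0] _ Km] b[of 0]
          by auto
        then show ?thesis by (intro exI[of _ s] exI[of _ t]) auto
      next
        assume "\<omega>0 > 2 - 2 * h"
        then have "v0 < 0" using assms(1) by (simp add: v0_eq mult_pos_neg)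
        then have "m + - \<omega>0 * (h + \<eta> 0) / 2 < - (K * \<delta>)"
          using end0[of 0] small(2) by (simp add: gap_def)
        then obtain s t where "0 < s" "s < h + \<eta> 0" "0 < t" "t < 1 - (h + \<eta> 0)"
            "- \<Psi> (0, h + \<eta> 0 - s) = - \<Psi> (0, h + \<eta> 0 + t)"
          using layer_profiles_take_opposite_values[OF profiles(1)[of 0] _ profiles(2)[of 0] _ Km] b[of 0]
          by auto
        then show ?thesis by auto
      qed
      then obtain s t where "0 < s" "s < h + \<eta> 0" "0 < t" "t < 1 - (h + \<eta> 0)"
          "\<Psi> (0, h + \<eta> 0 - s) = \<Psi> (0, h + \<eta> 0 + t)"
        by blast
      then show ?thesis
        using assms(3)
        by (intro vorticity_neq_function_of_stream_if_common_value
            [of "(0, h + \<eta> 0 - s)" _ _ "(0, h + \<eta> 0 + t)"])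
          (auto simp: lower_layer_def upper_layer_def)
    qed
    show "\<exists>\<gamma> :: real \<Rightarrow> real. \<forall>p\<in>fluid_domain h \<eta>. vorticity h \<omega>0 \<omega>1 \<eta> p = \<gamma> (\<Psi> p)"
      if range: "1 - 2 * h < \<omega>0 \<and> \<omega>0 < 2 - 2 * h"
    proof (rule vorticity_eq_function_of_stream_if_signs)
      have "0 < v0" "0 < v1"
        using range assms(1,2) by (simp_all add: v0_eq v1_eq)
      then have v: "K * \<delta> < m + - \<omega>0 * (h + \<eta> X) / 2" "K * \<delta> < m + \<omega>1 * (1 - (h + \<eta> X)) / 2" for X
        using end0[of X] end1[of X] small by (simp_all add: gap_def)
      fix p :: "real \<times> real"
      obtain X Y where p: "p = (X, Y)" by (cases p)
      show "\<Psi> p < 0" if "p \<in> lower_layer h \<eta>"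
        using layer_profile_pos[OF profiles(1)[of X], of "h + \<eta> X - Y"] Km v[of X] that
        by (auto simp: p lower_layer_def)
      show "0 < \<Psi> p" if "p \<in> upper_layer h \<eta>"
        using layer_profile_pos[OF profiles(2)[of X], of "Y - (h + \<eta> X)"] Km v[of X] that
        by (auto simp: p upper_layer_def)
    qed
  qed
qed

end
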